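(* Let $\mathcal{H}$ be a complex Hilbert space, let $n$ be a positive integer, and let $A_{ij}\in\mathcal{B}(\mathcal{H})$ for all $i,j=1,2,\ldots,n$. Then $$w\left(\begin{bmatrix} A_{11}&A_{12}&\ldots&A_{1n}\\ A_{21}&A_{22}&\ldots&A_{2n}\\ \vdots&\vdots& &\vdots\\ A_{n1}&A_{n2}&\ldots&A_{nn}\end{bmatrix}\right)\leq w\left(\begin{bmatrix} w(A_{11})&a_{12}&\ldots&a_{1n}\\ 0&w(A_{22})&\ldots&a_{2n}\\ \vdots&\vdots& &\vdots\\ 0&0&\ldots&w(A_{nn})\end{bmatrix}\right),$$ where the matrix on the right is the upper triangular $n\times n$ complex matrix with diagonal entries $w(A_{ii})$ and, for $i<j$, $(i,j)$ entry $$a_{ij}=\left\||A_{ij}|+|A_{ji}^*|\right\|^{1/2}\left\||A_{ji}|+|A_{ij}^*|\right\|^{1/2}.$$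
   Context: $\mathcal{B}(\mathcal{H})$ is the algebra of bounded linear operators on $\mathcal{H}$ with operator norm $\|\cdot\|$. For $A\in\mathcal{B}(\mathcal{H})$, $|A|=(A^*A)^{1/2}$ and $|A^*|=(AA^* )^{1/2}$, and the numerical radius is $w(A)=\sup\{|\langle Ax,x\rangle|: x\in\mathcal{H},\ \|x\|=1\}$. The operator matrix $[A_{ij}]$ acts as a bounded operator on the Hilbert space direct sum $\oplus_{i=1}^n\mathcal{H}$, and its numerical radius is taken there; an $n\times n$ complex matrix is viewed as an operator on $\mathbb{C}^n$ with its standard inner product. *)

theory Defs
  imports "HOL-Analysis.Analysis" "HOL-Library.Nonpos_Ints"
begin

section \<open>Complex Hilbert spaces\<close>

text \<open>
  A complex Hilbert space is presented over the real inner product space with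
  \<open>x \<bullet> y = Re \<langle>x, y\<rangle>\<close>. Hence the norm is \<open>sqrt \<langle>x, x\<rangle>\<close>, and definiteness of the complex
  inner product comes from \<open>real_inner\<close> (see \<open>cinner_self\<close>, \<open>norm_eq_sqrt_cinner\<close> below).
  The inner product is linear in its first argument.
\<close>

class complex_hilbert = real_inner + complete_space +
  fixes scaleC :: "complex \<Rightarrow> 'a \<Rightarrow> 'a"  (infixr \<open>*\<^sub>C\<close> 75)
    and cinner :: "'a \<Rightarrow> 'a \<Rightarrow> complex"
  assumes scaleC_add_right: "c *\<^sub>C (x + y) = c *\<^sub>C x + c *\<^sub>C y"
    and scaleC_add_left: "(c + d) *\<^sub>C x = c *\<^sub>C x + d *\<^sub>C x"
    and scaleC_scaleC: "c *\<^sub>C (d *\<^sub>C x) = (c * d) *\<^sub>C x"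
    and scaleR_scaleC: "r *\<^sub>R x = complex_of_real r *\<^sub>C x"
    and cinner_add_left: "cinner (x + y) z = cinner x z + cinner y z"
    and cinner_scaleC_left: "cinner (c *\<^sub>C x) y = c * cinner x y"
    and cinner_commute: "cinner x y = cnj (cinner y x)"
    and inner_eq_Re_cinner: "x \<bullet> y = Re (cinner x y)"

lemma scaleC_one: "1 *\<^sub>C x = (x :: 'a::complex_hilbert)"
  using scaleR_scaleC[of 1 x] by simp

lemma cinner_self: "cinner x x = complex_of_real ((norm (x :: 'a::complex_hilbert))\<^sup>2)"
proof -
  have "Im (cinner x x) = 0"
    using arg_cong[OF cinner_commute[of x x], of Im] by simp
  then show ?thesis
    by (simp add: complex_eq_iff power2_norm_eq_inner inner_eq_Re_cinner)
qed

lemma norm_eq_sqrt_cinner: "norm (x :: 'a::complex_hilbert) = sqrt (Re (cinner x x))"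
  by (simp add: cinner_self)

instantiation complex :: complex_hilbert
begin

definition scaleC_complex :: "complex \<Rightarrow> complex \<Rightarrow> complex"
  where "scaleC_complex c x = c * x"

definition cinner_complex :: "complex \<Rightarrow> complex \<Rightarrow> complex"
  where "cinner_complex x y = x * cnj y"

instance
  by standard
    (simp_all add: scaleC_complex_def cinner_complex_def algebra_simps scaleR_conv_of_real
      inner_complex_def)

end

text \<open>
  The Hilbert space direct sum of copies of \<open>'a\<close> indexed by \<open>'n\<close>; the norm on \<open>'a ^ 'n\<close>
  is the Euclidean one.
\<close>

instantiation vec :: (complex_hilbert, finite) complex_hilbert
begin

definition scaleC_vec :: "complex \<Rightarrow> 'a ^ 'b \<Rightarrow> 'a ^ 'b"
  where "scaleC_vec c x = (\<chi> i. c *\<^sub>C (x $ i))"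

definition cinner_vec :: "'a ^ 'b \<Rightarrow> 'a ^ 'b \<Rightarrow> complex"
  where "cinner_vec x y = (\<Sum>i\<in>UNIV. cinner (x $ i) (y $ i))"

instance
proof
  fix c d :: complex and r :: real and x y z :: "'a ^ 'b"
  show "c *\<^sub>C (x + y) = c *\<^sub>C x + c *\<^sub>C y"
    by (simp add: scaleC_vec_def vec_eq_iff scaleC_add_right)
  show "(c + d) *\<^sub>C x = c *\<^sub>C x + d *\<^sub>C x"
    by (simp add: scaleC_vec_def vec_eq_iff scaleC_add_left)
  show "c *\<^sub>C (d *\<^sub>C x) = (c * d) *\<^sub>C x"
    by (simp add: scaleC_vec_def vec_eq_iff scaleC_scaleC)
  show "r *\<^sub>R x = complex_of_real r *\<^sub>C x"
    by (simp add: scaleC_vec_def vec_eq_iff scaleR_scaleC)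
  show "cinner (x + y) z = cinner x z + cinner y z"
    by (simp add: cinner_vec_def cinner_add_left sum.distrib)
  show "cinner (c *\<^sub>C x) y = c * cinner x y"
    by (simp add: cinner_vec_def scaleC_vec_def cinner_scaleC_left sum_distrib_left)
  show "cinner x y = cnj (cinner y x)"
    unfolding cinner_vec_def cnj_sum by (intro sum.cong refl cinner_commute)
  show "x \<bullet> y = Re (cinner x y)"
    by (simp add: cinner_vec_def inner_vec_def inner_eq_Re_cinner)
qed

end

section \<open>Bounded operators\<close>

definition bounded_clinear :: "('a::complex_hilbert \<Rightarrow> 'b::complex_hilbert) \<Rightarrow> bool"
  where "bounded_clinear T \<longleftrightarrow> bounded_linear T \<and> (\<forall>c x. T (c *\<^sub>C x) = c *\<^sub>C T x)"

definition hilbert_adjoint :: "('a::complex_hilbert \<Rightarrow> 'a) \<Rightarrow> 'a \<Rightarrow> 'a"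
  where "hilbert_adjoint T =
    (THE S. bounded_clinear S \<and> (\<forall>x y. cinner (T x) y = cinner x (S y)))"

definition positive_operator :: "('a::complex_hilbert \<Rightarrow> 'a) \<Rightarrow> bool"
  where "positive_operator T \<longleftrightarrow>
    bounded_clinear T \<and> (\<forall>x. cinner (T x) x \<in> \<real>\<^sub>\<ge>\<^sub>0)"

definition positive_sqrt :: "('a::complex_hilbert \<Rightarrow> 'a) \<Rightarrow> 'a \<Rightarrow> 'a"
  where "positive_sqrt T = (THE S. positive_operator S \<and> S \<circ> S = T)"

definition operator_abs :: "('a::complex_hilbert \<Rightarrow> 'a) \<Rightarrow> 'a \<Rightarrow> 'a"
  where "operator_abs T = positive_sqrt (hilbert_adjoint T \<circ> T)"

text \<open>
  The inserted \<open>0\<close> matters only for the zero space, which has no unit vectors; there the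
  numerical radius is \<open>0\<close>, whereas \<open>Sup {}\<close> is unspecified on the reals.
\<close>

definition numerical_radius :: "('a::complex_hilbert \<Rightarrow> 'a) \<Rightarrow> real"
  where "numerical_radius T = Sup (insert 0 {cmod (cinner (T x) x) | x. norm x = 1})"

definition block_operator ::
    "('n \<Rightarrow> 'n \<Rightarrow> 'a::complex_hilbert \<Rightarrow> 'a) \<Rightarrow> 'a ^ 'n::finite \<Rightarrow> 'a ^ 'n"
  where "block_operator A x = (\<chi> i. \<Sum>j\<in>UNIV. A i j (x $ j))"

end

(* For the block operator at a unit vector x, split the quadratic form into the diagonal terms
   \<langle>A\<^sub>i\<^sub>i x\<^sub>i, x\<^sub>i\<rangle>, bounded by w(A\<^sub>i\<^sub>i) \<parallel>x\<^sub>i\<parallel>\<^sup>2, and the pairs of cross terms for i < j. The mixed Schwarz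
   inequality |\<langle>T x, y\<rangle>|\<^sup>2 \<le> \<langle>|T| x, x\<rangle> \<langle>|T\<^sup>*| y, y\<rangle> and Cauchy-Schwarz in the plane bound each pair by
   a\<^sub>i\<^sub>j \<parallel>x\<^sub>i\<parallel> \<parallel>x\<^sub>j\<parallel>, and the resulting sum is the quadratic form of the scalar matrix at the unit vector
   (\<parallel>x\<^sub>1\<parallel>, ..., \<parallel>x\<^sub>n\<parallel>).

   The mixed Schwarz inequality needs no polar decomposition: since T |T| = |T\<^sup>*| T, for x = |T| u it is
   Cauchy-Schwarz for the form of |T\<^sup>*|, and both sides depend only on the component of x in the
   closure of the range of |T|. The square root of a positive A with \<parallel>A\<parallel> \<le> 1 is I - X, where X is the limit of
   X\<^sub>n\<^sub>+\<^sub>1 = (I - A + X\<^sub>n\<^sup>2)/2; the iteration converges in norm because its steps are dominated by those of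
   the same iteration on the reals started at I - A = 1. Intertwining relations pass to the limit,
   which yields T |T| = |T\<^sup>*| T, complex linearity of the root and its uniqueness. *)

theory Submission
  imports Defs
begin

instance complex_hilbert \<subseteq> banach ..

section \<open>Projection, Riesz representation and adjoints\<close>

text \<open>A sequence in \<open>S\<close> minimizing the distance to \<open>x\<close> is Cauchy by
  the parallelogram law. Its limit is a nearest point \<open>p\<close>, and first-order optimality
  in the directions \<open>s\<close> and \<open>- s\<close> gives orthogonality.\<close>

lemma orthogonal_projection_exists:
  fixes S :: "'a::{real_inner,complete_space} set"
  assumes S: "subspace S" "closed S"
  obtains p where "p \<in> S" "\<And>s. s \<in> S \<Longrightarrow> (x - p) \<bullet> s = 0"
proof -
  define d where "d = infdist x S"
  define e :: "nat \<Rightarrow> real" where "e = (\<lambda>n. inverse (real (Suc n)))"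
  have ne: "S \<noteq> {}" using subspace_0[OF S(1)] by blast
  have d0: "0 \<le> d" by (simp add: d_def infdist_nonneg)
  have dle: "d \<le> norm (x - s)" if "s \<in> S" for s
    using infdist_le[OF that, of x] by (simp add: d_def dist_norm)
  have "\<exists>s\<in>S. norm (x - s) < d + e n" for n
    using cInf_lessD[of "dist x ` S" "d + e n"] ne
    by (auto simp: d_def e_def dist_norm infdist_notempty)
  then obtain s where sS: "\<And>n. s n \<in> S" and s: "\<And>n. norm (x - s n) < d + e n"
    by metis
  \<comment> \<open>Parallelogram law for \<open>x - s m\<close> and \<open>x - s n\<close>: the
    midpoint stays in \<open>S\<close>, hence at distance at least \<open>d\<close> from
    \<open>x\<close>.\<close>
  have par: "(norm (s m - s n))\<^sup>2 \<le> 4 * ((d + e N)\<^sup>2 - d\<^sup>2)" if "m \<ge> N" "n \<ge> N" for m n N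
  proof -
    have mid: "(1/2) *\<^sub>R (s m + s n) \<in> S"
      by (intro subspace_scale subspace_add S sS)
    have *: "(norm (x - s k))\<^sup>2 \<le> (d + e N)\<^sup>2" if "k \<ge> N" for k
    proof -
      have "e k \<le> e N" using that by (simp add: e_def le_imp_inverse_le)
      then show ?thesis using s[of k] by (intro power_mono) auto
    qed
    have "(norm (s m - s n))\<^sup>2 =
        2 * (norm (x - s m))\<^sup>2 + 2 * (norm (x - s n))\<^sup>2 - 4 * (norm (x - (1/2) *\<^sub>R (s m + s n)))\<^sup>2"
      unfolding power2_norm_eq_inner
      by (simp add: inner_diff inner_add inner_commute algebra_simps)
    moreover have "d\<^sup>2 \<le> (norm (x - (1/2) *\<^sub>R (s m + s n)))\<^sup>2"
      by (intro power_mono dle mid d0)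
    ultimately show ?thesis using *[OF that(1)] *[OF that(2)] by argo
  qed
  have e0: "e \<longlonglongrightarrow> 0" unfolding e_def by (rule LIMSEQ_inverse_real_of_nat)
  have lim: "(\<lambda>N. 4 * ((d + e N)\<^sup>2 - d\<^sup>2)) \<longlonglongrightarrow> 4 * ((d + 0)\<^sup>2 - d\<^sup>2)"
    by (intro tendsto_intros e0)
  have "Cauchy s"
  proof (rule CauchyI)
    fix r :: real assume "0 < r"
    then have "0 < r\<^sup>2" by simp
    then obtain N where N: "4 * ((d + e N)\<^sup>2 - d\<^sup>2) < r\<^sup>2"
      using order_tendstoD(2)[OF lim, of "r\<^sup>2"] by (auto simp: eventually_sequentially)
    show "\<exists>M. \<forall>m\<ge>M. \<forall>n\<ge>M. norm (s m - s n) < r"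
      using par N \<open>0 < r\<close> by (meson le_less_trans less_imp_le power2_less_imp_less)
  qed
  then obtain p where p: "s \<longlonglongrightarrow> p" using Cauchy_convergent convergent_def by blast
  have pS: "p \<in> S" using closed_sequentially[OF S(2) _ p] sS by blast
  have "(\<lambda>n. norm (x - s n)) \<longlonglongrightarrow> norm (x - p)" "(\<lambda>n. d + e n) \<longlonglongrightarrow> d + 0"
    by (intro tendsto_intros p e0)+
  then have "norm (x - p) \<le> d + 0"
    by (rule LIMSEQ_le) (use s in \<open>auto intro: less_imp_le\<close>)
  then have min: "\<forall>z\<in>S. dist x p \<le> dist x z"
    using dle by (force simp: dist_norm)
  have half: "(x - p) \<bullet> s \<le> 0" if "s \<in> S" for s
    using any_closest_point_dot[OF subspace_imp_convex[OF S(1)] S(2) pS _ min, of "p + s"]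
      subspace_add[OF S(1) pS that] by simp
  have "(x - p) \<bullet> s = 0" if "s \<in> S" for s
    using half[OF that] half[of "- s"] subspace_neg[OF S(1) that] by (simp add: inner_diff)
  then show thesis using that pS by blast
qed

text \<open>The component \<open>u\<close> of \<open>z\<close> orthogonal to the kernel represents
  \<open>f\<close> up to a factor, because \<open>x - (f x / f z) *\<^sub>R u\<close> lies in the
  kernel for every \<open>x\<close>.\<close>

lemma riesz_representation_real:
  fixes f :: "'a::{real_inner,complete_space} \<Rightarrow> real"
  assumes f: "bounded_linear f"
  obtains y where "\<And>x. f x = x \<bullet> y"
proof (cases "\<forall>x. f x = 0")
  case True
  then show thesis by (intro that[of 0]) simp
next
  case False
  then obtain z where z: "f z \<noteq> 0" by blast
  interpret f: bounded_linear f by fact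
  define K where "K = {x. f x = 0}"
  have "subspace K" by (simp add: K_def subspace_def f.zero f.add f.scaleR)
  moreover have "closed K"
    unfolding K_def by (intro closed_Collect_eq continuous_intros linear_continuous_on f)
  ultimately obtain p where p: "p \<in> K" "\<And>s. s \<in> K \<Longrightarrow> (z - p) \<bullet> s = 0"
    using orthogonal_projection_exists by metis
  define u where "u = z - p"
  have fu: "f u = f z" using p(1) by (simp add: u_def f.diff K_def)
  then have uu: "u \<bullet> u \<noteq> 0" using z f.zero by auto
  show thesis
  proof (rule that[of "(f z / (u \<bullet> u)) *\<^sub>R u"])
    fix x
    have "x - (f x / f z) *\<^sub>R u \<in> K" using z by (simp add: K_def f.diff f.scaleR fu)
    then have "u \<bullet> (x - (f x / f z) *\<^sub>R u) = 0" using p(2) by (simp add: u_def)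
    then have "u \<bullet> x = f x / f z * (u \<bullet> u)" by (simp add: inner_diff)
    then show "f x = x \<bullet> ((f z / (u \<bullet> u)) *\<^sub>R u)"
      using z uu by (simp add: inner_commute[of x])
  qed
qed

text \<open>Riesz representation of the functional sending \<open>x\<close> to
  \<open>T x \<bullet> y\<close> defines \<open>S y\<close>; linearity follows because a vector is
  determined by its inner products.\<close>

lemma real_adjoint_exists:
  fixes T :: "'a::{real_inner,complete_space} \<Rightarrow>\<^sub>L 'b::real_inner"
  obtains S :: "'b \<Rightarrow>\<^sub>L 'a" where "\<And>x y. T x \<bullet> y = x \<bullet> S y"
proof -
  have "\<exists>z. \<forall>x. T x \<bullet> y = x \<bullet> z" for y
  proof -
    have "bounded_linear (\<lambda>x. T x \<bullet> y)"
      by (intro bounded_linear_inner_left_comp blinfun.bounded_linear_right)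
    then show ?thesis using riesz_representation_real by metis
  qed
  then obtain S where S: "\<And>x y. T x \<bullet> y = x \<bullet> S y" by metis
  have eqI: "u = v" if "\<And>x. x \<bullet> u = x \<bullet> v" for u v :: 'a
    using that vector_eq_ldot by blast
  have "bounded_linear S"
  proof (rule bounded_linear_intro[where K = "norm T"])
    show "S (x + y) = S x + S y" for x y
      by (rule eqI) (simp add: inner_add_right flip: S)
    show "S (r *\<^sub>R x) = r *\<^sub>R S x" for r x
      by (rule eqI) (simp flip: S)
    show "norm (S y) \<le> norm y * norm T" for y
    proof -
      have "norm (S y) * norm (S y) = T (S y) \<bullet> y"
        by (simp add: S flip: power2_norm_eq_inner power2_eq_square)
      also have "\<dots> \<le> norm (T (S y)) * norm y" by (rule norm_cauchy_schwarz)
      also have "\<dots> \<le> norm T * norm (S y) * norm y"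
        by (intro mult_right_mono norm_blinfun) simp
      finally have "norm (S y) * norm (S y) \<le> norm (S y) * (norm y * norm T)"
        by (simp add: ac_simps)
      then show ?thesis
        by (cases "norm (S y) = 0") auto
    qed
  qed
  then show thesis
    using that[of "Blinfun S"] S by (simp add: bounded_linear_Blinfun_apply)
qed

section \<open>Square roots of positive operators\<close>

text \<open>Fixed-point iteration for \<open>X = (B + X^2) / 2\<close>, which says
  \<open>(I - X)^2 = I - B\<close>.\<close>

primrec sqrt_iter :: "('a::real_normed_vector \<Rightarrow>\<^sub>L 'a) \<Rightarrow> nat \<Rightarrow> 'a \<Rightarrow>\<^sub>L 'a" where
  "sqrt_iter B 0 = 0"
| "sqrt_iter B (Suc n) = (1/2) *\<^sub>R (B + (sqrt_iter B n o\<^sub>L sqrt_iter B n))"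

text \<open>The same iteration at \<open>B = 1\<close>: an increasing sequence in [0, 1] that
  majorizes the operator iteration.\<close>

primrec scalar_sqrt_iter :: "nat \<Rightarrow> real" where
  "scalar_sqrt_iter 0 = 0"
| "scalar_sqrt_iter (Suc n) = (1 + (scalar_sqrt_iter n)\<^sup>2) / 2"

definition sqrt_lim :: "('a::real_normed_vector \<Rightarrow>\<^sub>L 'a) \<Rightarrow> 'a \<Rightarrow>\<^sub>L 'a"
  where "sqrt_lim B = lim (sqrt_iter B)"

lemma scalar_sqrt_iter_bounds: "0 \<le> scalar_sqrt_iter n \<and> scalar_sqrt_iter n \<le> 1"
  by (induction n) (auto simp: power_le_one)

lemma norm_sqrt_iter_le:
  assumes "norm B \<le> 1"
  shows "norm (sqrt_iter B n) \<le> scalar_sqrt_iter n"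
proof (induction n)
  case (Suc n)
  have "norm (sqrt_iter B n o\<^sub>L sqrt_iter B n) \<le> norm (sqrt_iter B n) * norm (sqrt_iter B n)"
    by (rule norm_blinfun_compose)
  also have "\<dots> \<le> (scalar_sqrt_iter n)\<^sup>2"
    unfolding power2_eq_square by (intro mult_mono Suc) (auto simp: scalar_sqrt_iter_bounds)
  finally show ?case
    using norm_triangle_ineq[of B "sqrt_iter B n o\<^sub>L sqrt_iter B n"] assms by simp
qed simp

text \<open>Each factor in \<open>X^2 - Y^2 = X (X - Y) + (X - Y) Y\<close> is bounded by its scalar
  counterpart, and \<open>s (s - t) + (s - t) t = s^2 - t^2\<close> closes the induction.\<close>

lemma norm_sqrt_iter_step:
  assumes B: "norm B \<le> 1"
  shows "norm (sqrt_iter B (Suc n) - sqrt_iter B n) \<le> scalar_sqrt_iter (Suc n) - scalar_sqrt_iter n"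
proof (induction n)
  case (Suc n)
  define X Y s t where "X = sqrt_iter B (Suc n)" and "Y = sqrt_iter B n"
    and "s = scalar_sqrt_iter (Suc n)" and "t = scalar_sqrt_iter n"
  have IH: "norm (X - Y) \<le> s - t" using Suc by (simp only: X_def Y_def s_def t_def)
  have X: "norm X \<le> s" and Y: "norm Y \<le> t"
    unfolding X_def Y_def s_def t_def using norm_sqrt_iter_le[OF B] by blast+
  have st: "0 \<le> s" "0 \<le> t" unfolding s_def t_def using scalar_sqrt_iter_bounds by blast+
  have "sqrt_iter B (Suc (Suc n)) - sqrt_iter B (Suc n) = (1/2) *\<^sub>R ((X o\<^sub>L X) - (Y o\<^sub>L Y))"
    unfolding sqrt_iter.simps(2)[of B "Suc n"] X_def[symmetric]
    by (simp add: X_def Y_def algebra_simps)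
  also have "(X o\<^sub>L X) - (Y o\<^sub>L Y) = (X o\<^sub>L (X - Y)) + ((X - Y) o\<^sub>L Y)"
    by (rule blinfun_eqI) (simp add: blinfun.bilinear_simps)
  finally have "norm (sqrt_iter B (Suc (Suc n)) - sqrt_iter B (Suc n))
      \<le> 1/2 * (norm (X o\<^sub>L (X - Y)) + norm ((X - Y) o\<^sub>L Y))"
    by (simp add: norm_triangle_ineq)
  also have "\<dots> \<le> 1/2 * (s * (s - t) + (s - t) * t)"
    using order_trans[OF norm_blinfun_compose mult_mono[OF X IH]]
      order_trans[OF norm_blinfun_compose mult_mono[OF IH Y]] st order_trans[OF norm_ge_zero IH]
    by (intro mult_left_mono add_mono) auto
  also have "\<dots> = scalar_sqrt_iter (Suc (Suc n)) - scalar_sqrt_iter (Suc n)"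
    unfolding scalar_sqrt_iter.simps(2)[of "Suc n"] s_def[symmetric]
    by (simp add: s_def t_def power2_eq_square algebra_simps diff_divide_distrib add_divide_distrib)
  finally show ?case .
qed (use B in simp)

lemma sqrt_iter_tendsto:
  fixes B :: "'a::banach \<Rightarrow>\<^sub>L 'a"
  assumes B: "norm B \<le> 1"
  shows "sqrt_iter B \<longlonglongrightarrow> sqrt_lim B"
proof -
  \<comment> \<open>The scalar step dominates a norm, here for the zero operator on the reals, so it
    is nonnegative.\<close>
  have "scalar_sqrt_iter n \<le> scalar_sqrt_iter (Suc n)" for n
    using order_trans[OF norm_ge_zero norm_sqrt_iter_step[of "0 :: real \<Rightarrow>\<^sub>L real" n]] by simp
  then have "incseq scalar_sqrt_iter" by (rule incseq_SucI)
  then have "Cauchy scalar_sqrt_iter"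
    using incseq_convergent[of scalar_sqrt_iter 1] scalar_sqrt_iter_bounds
    by (metis LIMSEQ_imp_Cauchy)
  have le: "norm (sqrt_iter B m - sqrt_iter B n) \<le> scalar_sqrt_iter m - scalar_sqrt_iter n"
    if "n \<le> m" for m n
    using that
  proof (induction m rule: dec_induct)
    case (step m)
    have "norm (sqrt_iter B (Suc m) - sqrt_iter B n) \<le>
      norm (sqrt_iter B (Suc m) - sqrt_iter B m) + norm (sqrt_iter B m - sqrt_iter B n)"
      by (rule order_trans[OF _ norm_triangle_ineq]) simp
    then show ?case using step.IH norm_sqrt_iter_step[OF B, of m] by linarith
  qed simp
  have "Cauchy (sqrt_iter B)"
  proof (rule CauchyI')
    fix e :: real assume "0 < e"
    then obtain M where M: "\<And>m n. m \<ge> M \<Longrightarrow> n \<ge> M \<Longrightarrow>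
        norm (scalar_sqrt_iter m - scalar_sqrt_iter n) < e"
      using CauchyD[OF \<open>Cauchy scalar_sqrt_iter\<close>] by blast
    show "\<exists>M. \<forall>m\<ge>M. \<forall>n>m. dist (sqrt_iter B m) (sqrt_iter B n) < e"
    proof (intro exI[of _ M] allI impI)
      fix m n assume mn: "M \<le> m" "m < n"
      then have "scalar_sqrt_iter n - scalar_sqrt_iter m < e" using M[of n m] by simp
      then show "dist (sqrt_iter B m) (sqrt_iter B n) < e"
        using le[of m n] mn by (simp add: dist_norm norm_minus_commute)
    qed
  qed
  then show ?thesis
    unfolding sqrt_lim_def using Cauchy_convergent convergent_LIMSEQ_iff by blast
qed

lemma sqrt_lim_eq:
  fixes B :: "'a::banach \<Rightarrow>\<^sub>L 'a"
  assumes B: "norm B \<le> 1"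
  shows "sqrt_lim B = (1/2) *\<^sub>R (B + (sqrt_lim B o\<^sub>L sqrt_lim B))"
proof (rule LIMSEQ_unique)
  show "(\<lambda>n. sqrt_iter B (Suc n)) \<longlonglongrightarrow> sqrt_lim B"
    using sqrt_iter_tendsto[OF B] by (rule LIMSEQ_Suc)
  show "(\<lambda>n. sqrt_iter B (Suc n)) \<longlonglongrightarrow> (1/2) *\<^sub>R (B + (sqrt_lim B o\<^sub>L sqrt_lim B))"
    unfolding sqrt_iter.simps
    by (intro tendsto_intros bounded_bilinear.tendsto[OF bounded_bilinear_blinfun_compose]
        sqrt_iter_tendsto B)
qed

lemma norm_sqrt_lim_le:
  fixes B :: "'a::banach \<Rightarrow>\<^sub>L 'a"
  assumes B: "norm B \<le> 1"
  shows "norm (sqrt_lim B) \<le> 1"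
  using norm_sqrt_iter_le[OF B] scalar_sqrt_iter_bounds
  by (intro tendsto_upperbound[OF tendsto_norm[OF sqrt_iter_tendsto[OF B]]]
      always_eventually allI) (auto intro: order_trans)

text \<open>The n-th iterates are one and the same real polynomial in \<open>B\<close> and in
  \<open>C\<close>, so \<open>T B = C T\<close> carries over to them and then to the limits.\<close>

lemma sqrt_lim_intertwine:
  fixes B :: "'a::banach \<Rightarrow>\<^sub>L 'a" and C :: "'b::banach \<Rightarrow>\<^sub>L 'b" and T :: "'a \<Rightarrow>\<^sub>L 'b"
  assumes "norm B \<le> 1" "norm C \<le> 1" and T: "\<And>x. T (B x) = C (T x)"
  shows "T (sqrt_lim B x) = sqrt_lim C (T x)"
proof (rule LIMSEQ_unique)
  have "T (sqrt_iter B n x) = sqrt_iter C n (T x)" for n x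
    by (induction n arbitrary: x) (simp_all add: blinfun.bilinear_simps T)
  then show "(\<lambda>n. T (sqrt_iter B n x)) \<longlonglongrightarrow> sqrt_lim C (T x)"
    by (auto intro!: tendsto_intros sqrt_iter_tendsto assms)
  show "(\<lambda>n. T (sqrt_iter B n x)) \<longlonglongrightarrow> T (sqrt_lim B x)"
    by (intro tendsto_intros sqrt_iter_tendsto assms)
qed

lemma sqrt_lim_symmetric:
  fixes B :: "'a::{real_inner,banach} \<Rightarrow>\<^sub>L 'a"
  assumes "norm B \<le> 1" and B: "\<And>x y. B x \<bullet> y = x \<bullet> B y"
  shows "sqrt_lim B x \<bullet> y = x \<bullet> sqrt_lim B y"
proof (rule LIMSEQ_unique)
  have "sqrt_iter B n x \<bullet> y = x \<bullet> sqrt_iter B n y" for n x y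
    by (induction n arbitrary: x y)
      (simp_all add: blinfun.bilinear_simps inner_add inner_add_right B)
  then show "(\<lambda>n. sqrt_iter B n x \<bullet> y) \<longlonglongrightarrow> x \<bullet> sqrt_lim B y"
    by (auto intro!: tendsto_intros sqrt_iter_tendsto assms)
  show "(\<lambda>n. sqrt_iter B n x \<bullet> y) \<longlonglongrightarrow> sqrt_lim B x \<bullet> y"
    by (intro tendsto_intros sqrt_iter_tendsto assms)
qed

text \<open>Symmetry is stated separately because over the reals a nonnegative quadratic form does
  not force it.\<close>

definition psd :: "('a::real_inner \<Rightarrow>\<^sub>L 'a) \<Rightarrow> bool"
  where "psd A \<longleftrightarrow> (\<forall>x y. A x \<bullet> y = x \<bullet> A y) \<and> (\<forall>x. 0 \<le> A x \<bullet> x)"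

lemma psd_symmetric: "psd A \<Longrightarrow> A x \<bullet> y = x \<bullet> A y"
  and psd_nonneg: "psd A \<Longrightarrow> 0 \<le> A x \<bullet> x"
  unfolding psd_def by blast+

lemma psd_cauchy_schwarz:
  assumes A: "psd A"
  shows "(A x \<bullet> y)\<^sup>2 \<le> (A x \<bullet> x) * (A y \<bullet> y)"
proof -
  define a b c where "a = A x \<bullet> x" and "b = A x \<bullet> y" and "c = A y \<bullet> y"
  have ac: "0 \<le> a" "0 \<le> c" using psd_nonneg[OF A] by (auto simp: a_def c_def)
  have "A y \<bullet> x = b" using psd_symmetric[OF A, of y x] by (simp add: b_def inner_commute)
  then have q: "0 \<le> s\<^sup>2 * a + 2 * s * t * b + t\<^sup>2 * c" for s t
    using psd_nonneg[OF A, of "s *\<^sub>R x + t *\<^sub>R y"]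
    by (simp add: blinfun.bilinear_simps inner_add a_def b_def c_def power2_eq_square algebra_simps)
  have "b\<^sup>2 \<le> a * c"
  proof (cases "c = 0")
    case True
    have "b = 0"
    proof (rule ccontr)
      assume "b \<noteq> 0"
      \<comment> \<open>At this choice the form takes the value
        \<open>a - (a + 1) = -1\<close>.\<close>
      with q[of 1 "- (a + 1) / (2 * b)"] True have "0 \<le> a + (- (2 * a) - 2) / 2" by simp
      then show False by (simp add: field_simps)
    qed
    then show ?thesis using True by simp
  next
    case False
    then have "0 < c" using ac by simp
    \<comment> \<open>\<open>s = c\<close>, \<open>t = - b\<close> is, up to scaling, where the form
      is smallest along the line through \<open>x\<close> in direction \<open>y\<close>.\<close>
    have "0 \<le> c * (a * c - b\<^sup>2)"
      using q[of c "- b"] by (simp add: power2_eq_square algebra_simps)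
    then show ?thesis using \<open>0 < c\<close> by (simp add: zero_le_mult_iff)
  qed
  then show ?thesis by (simp add: a_def b_def c_def)
qed

text \<open>Cauchy-Schwarz for the form of \<open>A\<close> at \<open>x\<close> and
  \<open>A x\<close>, followed by division by \<open>(norm (A x))\<^sup>2\<close>.\<close>

lemma psd_norm_apply_le:
  assumes A: "psd A"
  shows "(norm (A x))\<^sup>2 \<le> norm A * (A x \<bullet> x)"
proof -
  define n where "n = (norm (A x))\<^sup>2"
  have "n\<^sup>2 = (A x \<bullet> A x)\<^sup>2" by (simp add: n_def power2_norm_eq_inner)
  also have "\<dots> \<le> (A x \<bullet> x) * (A (A x) \<bullet> A x)" by (rule psd_cauchy_schwarz[OF A])
  also have "\<dots> \<le> (A x \<bullet> x) * (norm A * n)"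
  proof (intro mult_left_mono psd_nonneg[OF A])
    have "A (A x) \<bullet> A x \<le> norm A * norm (A x) * norm (A x)"
      by (rule order_trans[OF norm_cauchy_schwarz mult_right_mono[OF norm_blinfun]]) simp
    then show "A (A x) \<bullet> A x \<le> norm A * n" by (simp add: n_def power2_eq_square ac_simps)
  qed
  finally have *: "n * n \<le> n * (norm A * (A x \<bullet> x))" by (simp add: power2_eq_square ac_simps)
  have "n \<le> norm A * (A x \<bullet> x)"
  proof (cases "n = 0")
    case True
    then show ?thesis using psd_nonneg[OF A, of x] by simp
  next
    case False
    then have "0 < n" by (simp add: n_def)
    then show ?thesis using * by (simp only: mult_le_cancel_left_pos)
  qed
  then show ?thesis by (simp add: n_def)
qed

lemma psd_apply_eq_zero:
  assumes "psd A" "A x \<bullet> x = 0"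
  shows "A x = 0"
  using psd_norm_apply_le[OF assms(1), of x] assms(2) by simp

text \<open>
  For every \<open>r > 0\<close> with \<open>norm A \<le> r\<close> this is the same operator; the parameter makes
  \<open>T\<^sup>*T\<close> and \<open>TT\<^sup>*\<close> use a common \<open>r\<close>, as intertwining requires.
\<close>

definition psd_root :: "real \<Rightarrow> ('a::real_normed_vector \<Rightarrow>\<^sub>L 'a) \<Rightarrow> 'a \<Rightarrow>\<^sub>L 'a"
  where "psd_root r A = sqrt r *\<^sub>R (id_blinfun - sqrt_lim (id_blinfun - (1/r) *\<^sub>R A))"

text \<open>In the expansion of the squared norm of \<open>x - A x / r\<close>, the quadratic term
  is at most \<open>a / r\<close>, while the mixed term subtracts
  \<open>2 * (a / r)\<close>.\<close>

lemma norm_id_minus_psd_le: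
  assumes A: "psd A" "norm A \<le> r" and r: "0 < r"
  shows "norm (id_blinfun - (1/r) *\<^sub>R A) \<le> 1"
proof (rule norm_blinfun_bound)
  fix x
  define a where "a = A x \<bullet> x"
  have a: "0 \<le> a" using psd_nonneg[OF A(1)] by (simp add: a_def)
  have "(norm (A x))\<^sup>2 \<le> norm A * a" using psd_norm_apply_le[OF A(1)] by (simp add: a_def)
  also have "\<dots> \<le> r * a" using A(2) a by (rule mult_right_mono)
  finally have le: "(norm (A x))\<^sup>2 / r\<^sup>2 \<le> a / r"
    using r by (simp add: power2_eq_square field_simps)
  have "(norm (x - (1/r) *\<^sub>R A x))\<^sup>2 = (norm x)\<^sup>2 - 2 * (a / r) + (norm (A x))\<^sup>2 / r\<^sup>2"
    unfolding power2_norm_eq_inner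
    by (simp add: inner_diff inner_diff_right inner_commute a_def)
      (simp add: power2_eq_square field_simps)
  also have "\<dots> \<le> (norm x)\<^sup>2" using le divide_nonneg_pos[OF a r] by linarith
  finally show "norm ((id_blinfun - (1/r) *\<^sub>R A) x) \<le> 1 * norm x"
    by (simp add: blinfun.bilinear_simps power2_le_iff_abs_le)
qed simp

text \<open>The limit \<open>X\<close> is symmetric with norm at most 1, so \<open>I - X\<close> is
  positive semidefinite.\<close>

lemma psd_psd_root:
  fixes A :: "'a::{real_inner,banach} \<Rightarrow>\<^sub>L 'a"
  assumes A: "psd A" "norm A \<le> r" and r: "0 < r"
  shows "psd (psd_root r A)"
proof -
  define B X where "B = id_blinfun - (1/r) *\<^sub>R A" and "X = sqrt_lim B"
  have B: "norm B \<le> 1" using norm_id_minus_psd_le[OF assms] by (simp add: B_def)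
  have "B x \<bullet> y = x \<bullet> B y" for x y
    by (simp add: B_def blinfun.bilinear_simps inner_diff psd_symmetric[OF A(1)] inner_diff_right)
  then have sym: "X x \<bullet> y = x \<bullet> X y" for x y
    using sqrt_lim_symmetric[OF B] by (simp add: X_def)
  have "X x \<bullet> x \<le> x \<bullet> x" for x
  proof -
    have "X x \<bullet> x \<le> norm (X x) * norm x" by (rule norm_cauchy_schwarz)
    also have "\<dots> \<le> (norm X * norm x) * norm x"
      by (intro mult_right_mono norm_blinfun) simp
    also have "\<dots> \<le> (1 * norm x) * norm x"
      using norm_sqrt_lim_le[OF B] by (intro mult_right_mono) (auto simp: X_def)
    finally show ?thesis by (simp add: norm_eq_sqrt_inner)
  qed
  then show ?thesis
    using r by (simp add: psd_def psd_root_def blinfun.bilinear_simps inner_diff inner_diff_right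
        sym flip: B_def X_def)
qed

text \<open>The fixed-point equation gives \<open>(I - X)^2 = I - 2 X + X^2 = I - B = A / r\<close>;
  the factor \<open>sqrt r\<close> undoes the scaling.\<close>

lemma psd_root_square:
  fixes A :: "'a::{real_inner,banach} \<Rightarrow>\<^sub>L 'a"
  assumes A: "psd A" "norm A \<le> r" and r: "0 < r"
  shows "psd_root r A (psd_root r A x) = A x"
proof -
  define B X where "B = id_blinfun - (1/r) *\<^sub>R A" and "X = sqrt_lim B"
  have B: "norm B \<le> 1" using norm_id_minus_psd_le[OF assms] by (simp add: B_def)
  have "X x = (1/2) *\<^sub>R (B x + X (X x))"
    using arg_cong[OF sqrt_lim_eq[OF B], of "\<lambda>F. F x"]
    by (simp add: blinfun.bilinear_simps flip: X_def)
  then have "2 *\<^sub>R X x = B x + X (X x)"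
    by (metis (no_types) divide_self_if scaleR_one scaleR_scaleR times_divide_eq_right mult.right_neutral zero_neq_numeral)
  then have XX: "X (X x) = 2 *\<^sub>R X x - B x" by simp
  have "psd_root r A (psd_root r A x) = r *\<^sub>R (x - 2 *\<^sub>R X x + X (X x))"
    using r by (simp add: psd_root_def blinfun.bilinear_simps algebra_simps scaleR_2 flip: B_def X_def)
  also have "\<dots> = A x" using r by (simp add: XX B_def blinfun.bilinear_simps)
  finally show ?thesis .
qed

lemma psd_root_intertwine:
  fixes A :: "'a::{real_inner,banach} \<Rightarrow>\<^sub>L 'a" and C :: "'b::{real_inner,banach} \<Rightarrow>\<^sub>L 'b"
    and T :: "'a \<Rightarrow>\<^sub>L 'b"
  assumes "psd A" "norm A \<le> r" "psd C" "norm C \<le> r" "0 < r"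
    and T: "\<And>x. T (A x) = C (T x)"
  shows "T (psd_root r A x) = psd_root r C (T x)"
proof -
  have "T (sqrt_lim (id_blinfun - (1/r) *\<^sub>R A) x) = sqrt_lim (id_blinfun - (1/r) *\<^sub>R C) (T x)"
    by (intro sqrt_lim_intertwine norm_id_minus_psd_le assms(1-5))
      (simp add: blinfun.bilinear_simps T)
  then show ?thesis by (simp add: psd_root_def blinfun.bilinear_simps)
qed

text \<open>On \<open>y = P x - S x\<close> the sum \<open>P + S\<close> vanishes, since
  \<open>P\<close> and \<open>S\<close> commute and have equal squares. Both forms are nonnegative,
  so \<open>P y = S y = 0\<close>, and symmetry gives \<open>y \<bullet> y = 0\<close>.\<close>

lemma psd_root_unique:
  fixes A :: "'a::{real_inner,banach} \<Rightarrow>\<^sub>L 'a"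
  assumes A: "psd A" "norm A \<le> r" "0 < r" and S: "psd S" "\<And>x. S (S x) = A x"
  shows "S = psd_root r A"
proof (rule blinfun_eqI)
  fix x
  define P where "P = psd_root r A"
  have P: "psd P" "\<And>x. P (P x) = A x"
    using psd_psd_root[OF A] psd_root_square[OF A] by (simp_all add: P_def)
  \<comment> \<open>\<open>S\<close> commutes with its square \<open>A\<close>, hence with the root
    obtained from \<open>A\<close>.\<close>
  have comm: "S (P z) = P (S z)" for z
    unfolding P_def by (intro psd_root_intertwine A) (simp flip: S(2))
  define y where "y = P x - S x"
  have "P y + S y = 0" by (simp add: y_def blinfun.bilinear_simps comm P(2) S(2))
  then have "P y \<bullet> y + S y \<bullet> y = 0" by (simp flip: inner_add_left)
  then have "P y \<bullet> y = 0" "S y \<bullet> y = 0"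
    using psd_nonneg[OF P(1), of y] psd_nonneg[OF S(1), of y] by linarith+
  then have "P y = 0" "S y = 0" using psd_apply_eq_zero P(1) S(1) by blast+
  then have "y \<bullet> y = 0"
    using psd_symmetric[OF P(1), of x y] psd_symmetric[OF S(1), of x y]
    unfolding y_def by (simp add: inner_diff_left)
  then show "S x = psd_root r A x" by (simp add: y_def P_def)
qed

section \<open>The mixed Schwarz inequality for the real inner product\<close>

lemma subspace_closure:
  fixes S :: "'a::real_normed_vector set"
  assumes "subspace S"
  shows "subspace (closure S)"
  unfolding subspace_def
proof (intro conjI ballI allI)
  show "0 \<in> closure S" using subspace_0[OF assms] closure_subset by blast
  fix x assume "x \<in> closure S"
  then obtain s where s: "\<And>n. s n \<in> S" "s \<longlonglongrightarrow> x" unfolding closure_sequential by blast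
  show "c *\<^sub>R x \<in> closure S" for c
    unfolding closure_sequential
    by (intro exI[of _ "\<lambda>n. c *\<^sub>R s n"] conjI allI tendsto_intros s subspace_scale assms)
  fix y assume "y \<in> closure S"
  then obtain t where t: "\<And>n. t n \<in> S" "t \<longlonglongrightarrow> y" unfolding closure_sequential by blast
  show "x + y \<in> closure S"
    unfolding closure_sequential
    by (intro exI[of _ "\<lambda>n. s n + t n"] conjI allI tendsto_intros s t subspace_add assms)
qed

lemma psd_adjoint_compose:
  fixes T :: "'a::real_inner \<Rightarrow>\<^sub>L 'b::real_inner" and S :: "'b \<Rightarrow>\<^sub>L 'a"
  assumes "\<And>x y. T x \<bullet> y = x \<bullet> S y"
  shows "psd (S o\<^sub>L T)"
  by (simp add: psd_def inner_commute[of "S _"] flip: assms) (simp add: inner_commute)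

text \<open>Both products \<open>S T\<close> and \<open>T S\<close> have norm at most
  \<open>norm S * norm T\<close>, so a common \<open>r\<close> serves for the two roots and
  \<open>T P = Q T\<close> holds.\<close>

lemma mixed_schwarz_real:
  fixes T :: "'a::{real_inner,banach} \<Rightarrow>\<^sub>L 'b::{real_inner,banach}" and S :: "'b \<Rightarrow>\<^sub>L 'a"
  assumes adj: "\<And>x y. T x \<bullet> y = x \<bullet> S y" and r: "norm S * norm T \<le> r" "0 < r"
  defines "P \<equiv> psd_root r (S o\<^sub>L T)" and "Q \<equiv> psd_root r (T o\<^sub>L S)"
  shows "(T x \<bullet> y)\<^sup>2 \<le> (P x \<bullet> x) * (Q y \<bullet> y)"
proof -
  have adj': "S y \<bullet> x = y \<bullet> T x" for x y using adj[of x y] by (simp add: inner_commute)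
  have ST: "psd (S o\<^sub>L T)" "norm (S o\<^sub>L T) \<le> r" and TS: "psd (T o\<^sub>L S)" "norm (T o\<^sub>L S) \<le> r"
    using psd_adjoint_compose[OF adj] psd_adjoint_compose[OF adj'] r(1)
      norm_blinfun_compose[of S T] norm_blinfun_compose[of T S] by (auto simp: mult.commute)
  have P: "psd P" "\<And>x. P (P x) = S (T x)" and Q: "psd Q"
    using psd_psd_root psd_root_square[OF ST r(2)] ST TS r(2) by (auto simp: P_def Q_def)
  have TP: "T (P x) = Q (T x)" for x
    unfolding P_def Q_def using ST TS r(2) by (intro psd_root_intertwine) auto
  have ker: "T x = 0" if "P x = 0" for x
  proof -
    have "T x \<bullet> T x = 0" using that P(2)[of x] by (simp add: adj)
    then show ?thesis by simp
  qed
  have range: "(T z \<bullet> y)\<^sup>2 \<le> (P z \<bullet> z) * (Q y \<bullet> y)" if "z \<in> range P" for z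
  proof -
    from that obtain u where z: "z = P u" by blast
    have "(Q (T u) \<bullet> y)\<^sup>2 \<le> (Q (T u) \<bullet> T u) * (Q y \<bullet> y)" by (rule psd_cauchy_schwarz[OF Q])
    also have "Q (T u) \<bullet> T u = P z \<bullet> z"
      by (simp add: z adj P(2)[symmetric] psd_symmetric[OF P(1)] flip: TP)
    finally show ?thesis by (simp add: z TP)
  qed
  have closure: "(T z \<bullet> y)\<^sup>2 \<le> (P z \<bullet> z) * (Q y \<bullet> y)" if z: "z \<in> closure (range P)" for z
  proof -
    obtain s where s: "\<And>n. s n \<in> range P" "s \<longlonglongrightarrow> z"
      using z unfolding closure_sequential by blast
    show ?thesis
    proof (rule LIMSEQ_le)
      show "(\<lambda>n. (T (s n) \<bullet> y)\<^sup>2) \<longlonglongrightarrow> (T z \<bullet> y)\<^sup>2"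
        "(\<lambda>n. (P (s n) \<bullet> s n) * (Q y \<bullet> y)) \<longlonglongrightarrow> (P z \<bullet> z) * (Q y \<bullet> y)"
        by (intro tendsto_intros s(2))+
    qed (use range s(1) in blast)
  qed
  have "subspace (closure (range P))"
    by (intro subspace_closure linear_subspace_image subspace_UNIV
        bounded_linear.linear blinfun.bounded_linear_right)
  then obtain p where p: "p \<in> closure (range P)"
    and orth: "\<And>s. s \<in> closure (range P) \<Longrightarrow> (x - p) \<bullet> s = 0"
    using orthogonal_projection_exists[of "closure (range P)" x] by auto
  \<comment> \<open>The residual \<open>x - p\<close> is orthogonal to the range of
    \<open>P\<close>, hence killed by \<open>P\<close> and by \<open>T\<close>; replacing
    \<open>x\<close> by \<open>p\<close> changes neither side.\<close>
  have "(x - p) \<bullet> P (P (x - p)) = 0" using orth closure_subset by blast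
  then have "P (x - p) \<bullet> P (x - p) = 0" by (simp only: psd_symmetric[OF P(1)])
  then have 0: "P (x - p) = 0" by simp
  then have "T x = T p" "P x = P p" using ker[OF 0] by (auto simp: blinfun.bilinear_simps)
  moreover have "P p \<bullet> x = P p \<bullet> p"
    using 0 psd_symmetric[OF P(1), of p "x - p"] by (simp add: inner_diff_right)
  ultimately show ?thesis using closure[OF p] by simp
qed

section \<open>Complex adjoints and absolute values\<close>

lemma cinner_scaleC_right: "cinner x (c *\<^sub>C y) = cnj c * cinner (x :: 'a::complex_hilbert) y"
  using cinner_commute[of x "c *\<^sub>C y"] cinner_commute[of y x] by (simp add: cinner_scaleC_left)

lemma cinner_scaleR_left: "cinner (r *\<^sub>R x) y = of_real r * cinner (x :: 'a::complex_hilbert) y"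
  by (simp add: scaleR_scaleC cinner_scaleC_left)

lemma cinner_scaleR_right: "cinner x (r *\<^sub>R y) = of_real r * cinner (x :: 'a::complex_hilbert) y"
  by (simp add: scaleR_scaleC cinner_scaleC_right)

lemma cinner_sum_left:
  "cinner (\<Sum>i\<in>I. f i) (y :: 'a::complex_hilbert) = (\<Sum>i\<in>I. cinner (f i) y)"
proof (induction I rule: infinite_finite_induct)
  have "cinner 0 y = 0" using cinner_scaleR_left[of 0 y y] by simp
  then show "cinner (\<Sum>i\<in>{}. f i) y = (\<Sum>i\<in>{}. cinner (f i) y)"
    "infinite A \<Longrightarrow> cinner (\<Sum>i\<in>A. f i) y = (\<Sum>i\<in>A. cinner (f i) y)" for A by simp_all
qed (simp add: cinner_add_left)

lemma inner_scaleC_scaleC: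
  fixes x y :: "'a::complex_hilbert"
  shows "(c *\<^sub>C x) \<bullet> (c *\<^sub>C y) = (cmod c)\<^sup>2 * (x \<bullet> y)"
proof -
  have "cinner (c *\<^sub>C x) (c *\<^sub>C y) = of_real ((cmod c)\<^sup>2) * cinner x y"
    by (simp add: cinner_scaleC_left cinner_scaleC_right complex_norm_square mult.assoc
        del: of_real_power)
  then show ?thesis by (simp add: inner_eq_Re_cinner del: of_real_power)
qed

lemma norm_scaleC: "norm (c *\<^sub>C x) = cmod c * norm (x :: 'a::complex_hilbert)"
  by (simp add: norm_eq_sqrt_inner inner_scaleC_scaleC real_sqrt_mult)

lemma bounded_linear_scaleC: "bounded_linear (\<lambda>x :: 'a::complex_hilbert. c *\<^sub>C x)"
  by (rule bounded_linear_intro[where K = "cmod c"])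
    (simp_all add: scaleC_add_right scaleR_scaleC scaleC_scaleC norm_scaleC mult.commute)

text \<open>Multiplying \<open>x\<close> by the imaginary unit turns the real part into minus the
  imaginary part, so the real inner product recovers the complex one.\<close>

lemma cinner_eqI:
  fixes x y :: "'a::complex_hilbert" and u v :: "'b::complex_hilbert"
  assumes "\<And>c. (c *\<^sub>C x) \<bullet> y = (c *\<^sub>C u) \<bullet> v"
  shows "cinner x y = cinner u v"
  using assms[of 1] assms[of \<i>]
  by (simp add: inner_eq_Re_cinner cinner_scaleC_left complex_eq_iff)

text \<open>A unimodular factor rotates the inner product onto the nonnegative axis, which reduces
  estimates of its modulus to real ones.\<close>

lemma cmod_cinner_phase:
  fixes x y :: "'a::complex_hilbert"
  obtains c where "cmod c = 1" "(c *\<^sub>C x) \<bullet> y = cmod (cinner x y)"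
proof (cases "cinner x y = 0")
  case True
  then show thesis by (intro that[of 1]) (simp_all add: inner_eq_Re_cinner cinner_scaleC_left)
next
  case False
  define z where "z = cinner x y"
  have z: "z \<noteq> 0" using False by (simp add: z_def)
  show thesis
  proof (rule that[of "cnj z / of_real (cmod z)"])
    show "cmod (cnj z / of_real (cmod z)) = 1" using z by (simp add: norm_divide)
    have "cnj z * z = of_real (cmod z * cmod z)"
      using complex_norm_square[of z] by (simp add: power2_eq_square mult.commute)
    then have "cnj z / of_real (cmod z) * z = of_real (cmod z)"
      using z by (simp add: field_simps)
    then show "((cnj z / of_real (cmod z)) *\<^sub>C x) \<bullet> y = cmod (cinner x y)"
      by (simp add: inner_eq_Re_cinner cinner_scaleC_left flip: z_def)
  qed
qed

lemma cmod_cinner_le: "cmod (cinner x y) \<le> norm x * norm (y :: 'a::complex_hilbert)"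
proof -
  obtain c where c: "cmod c = 1" "(c *\<^sub>C x) \<bullet> y = cmod (cinner x y)"
    by (rule cmod_cinner_phase)
  show ?thesis using norm_cauchy_schwarz[of "c *\<^sub>C x" y] c by (simp add: norm_scaleC)
qed

section \<open>Adjoints of complex-linear operators\<close>

lemma hilbert_adjointI:
  fixes T :: "'a::complex_hilbert \<Rightarrow> 'a"
  assumes "bounded_clinear S" and S: "\<And>x y. cinner (T x) y = cinner x (S y)"
  shows "hilbert_adjoint T = S"
  unfolding hilbert_adjoint_def
proof (rule the_equality)
  fix R assume R: "bounded_clinear R \<and> (\<forall>x y. cinner (T x) y = cinner x (R y))"
  show "R = S"
  proof
    fix y
    have "x \<bullet> R y = x \<bullet> S y" for x
      using R S[of x y] by (simp add: inner_eq_Re_cinner)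
    then show "R y = S y" using vector_eq_ldot by blast
  qed
qed (use assms in blast)

text \<open>The adjoint for the real inner product already is the complex one: \<open>T\<close>
  commutes with complex scalars, so the real identity holds for every multiple of
  \<open>x\<close>.\<close>

lemma hilbert_adjoint_exists:
  fixes T :: "'a::complex_hilbert \<Rightarrow> 'a"
  assumes T: "bounded_clinear T"
  obtains S where "bounded_clinear S" "\<And>x y. cinner (T x) y = cinner x (S y)"
proof -
  have ap: "blinfun_apply (Blinfun T) = T"
    using T by (simp add: bounded_clinear_def bounded_linear_Blinfun_apply)
  obtain S :: "'a \<Rightarrow>\<^sub>L 'a" where S: "\<And>x y. T x \<bullet> y = x \<bullet> S y"
    using real_adjoint_exists[of "Blinfun T"] unfolding ap by metis
  have adj: "cinner (T x) y = cinner x (S y)" for x y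
    using T by (intro cinner_eqI) (simp add: bounded_clinear_def flip: S)
  have "S (c *\<^sub>C y) = c *\<^sub>C S y" for c y
  proof -
    have "cinner x (S (c *\<^sub>C y)) = cinner x (c *\<^sub>C S y)" for x
      unfolding cinner_scaleC_right by (simp add: cinner_scaleC_right flip: adj)
    then have "x \<bullet> S (c *\<^sub>C y) = x \<bullet> (c *\<^sub>C S y)" for x by (simp add: inner_eq_Re_cinner)
    then show ?thesis using vector_eq_ldot by blast
  qed
  then show thesis
    using that[of S] adj by (simp add: bounded_clinear_def blinfun.bounded_linear_right)
qed

lemma
  fixes T :: "'a::complex_hilbert \<Rightarrow> 'a"
  assumes T: "bounded_clinear T"
  shows bounded_clinear_hilbert_adjoint: "bounded_clinear (hilbert_adjoint T)"
    and cinner_hilbert_adjoint: "cinner (T x) y = cinner x (hilbert_adjoint T y)"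
    and hilbert_adjoint_hilbert_adjoint: "hilbert_adjoint (hilbert_adjoint T) = T"
proof -
  obtain S where S: "bounded_clinear S" "\<And>x y. cinner (T x) y = cinner x (S y)"
    using hilbert_adjoint_exists[OF T] by blast
  have eq: "hilbert_adjoint T = S" using hilbert_adjointI S by blast
  show "bounded_clinear (hilbert_adjoint T)" "cinner (T x) y = cinner x (hilbert_adjoint T y)"
    using S by (simp_all add: eq)
  have "cinner (S x) y = cinner x (T y)" for x y
    using S(2)[of y x] cinner_commute[of "S x" y] cinner_commute[of x "T y"] by simp
  then show "hilbert_adjoint (hilbert_adjoint T) = T"
    unfolding eq by (intro hilbert_adjointI T)
qed

text \<open>Symmetry comes from polarization: the complex form is real at
  \<open>\<i> *\<^sub>C x + y\<close>, and its imaginary part there is the difference of the two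
  mixed real parts.\<close>

lemma positive_operator_imp_psd:
  fixes T :: "'a::complex_hilbert \<Rightarrow> 'a"
  assumes "positive_operator T"
  shows "psd (Blinfun T)"
proof -
  have T: "bounded_linear T" "\<And>c x. T (c *\<^sub>C x) = c *\<^sub>C T x"
    and pos: "\<And>x. cinner (T x) x \<in> \<real>\<^sub>\<ge>\<^sub>0"
    using assms by (auto simp: positive_operator_def bounded_clinear_def)
  interpret T: bounded_linear T by (rule T(1))
  have real: "Im (cinner (T x) x) = 0" "0 \<le> Re (cinner (T x) x)" for x
    using pos[of x] by (auto simp: complex_nonneg_Reals_iff)
  have "T x \<bullet> y = x \<bullet> T y" for x y
  proof -
    have add_right: "cinner u (v + w) = cinner u v + cinner u w" for u v w :: 'a
      using cinner_commute[of u "v + w"] cinner_commute[of u v] cinner_commute[of u w]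
      by (simp add: cinner_add_left)
    have "Im (cinner (T (\<i> *\<^sub>C x + y)) (\<i> *\<^sub>C x + y)) = Re (cinner (T x) y) - Re (cinner (T y) x)"
      using real(1)[of x] real(1)[of y]
      by (simp add: T.add T(2) cinner_add_left add_right cinner_scaleC_left cinner_scaleC_right)
    then show ?thesis
      using real(1)[of "\<i> *\<^sub>C x + y"] cinner_commute[of x "T y"]
      by (simp add: inner_eq_Re_cinner)
  qed
  then show ?thesis
    using real(2) by (simp add: psd_def bounded_linear_Blinfun_apply[OF T(1)] inner_eq_Re_cinner)
qed

lemma positive_operator_psd:
  fixes P :: "'a::complex_hilbert \<Rightarrow>\<^sub>L 'a"
  assumes P: "psd P" and scale: "\<And>c x. P (c *\<^sub>C x) = c *\<^sub>C P x"
  shows "positive_operator P"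
proof -
  have "cinner (P x) x = cinner x (P x)" for x
    by (rule cinner_eqI) (simp add: psd_symmetric[OF P] flip: scale)
  then have "Im (cinner (P x) x) = 0" for x
    using arg_cong[OF cinner_commute[of "P x" x], of Im] by simp
  then show ?thesis
    using psd_nonneg[OF P] scale
    by (simp add: positive_operator_def bounded_clinear_def blinfun.bounded_linear_right
        complex_nonneg_Reals_iff inner_eq_Re_cinner)
qed

text \<open>Multiplication by \<open>c\<close> is a bounded real-linear map commuting with
  \<open>A\<close>, so it commutes with the root.\<close>

lemma psd_root_scaleC:
  fixes A :: "'a::complex_hilbert \<Rightarrow>\<^sub>L 'a"
  assumes A: "psd A" "norm A \<le> r" "0 < r" and scale: "\<And>c x. A (c *\<^sub>C x) = c *\<^sub>C A x"
  shows "psd_root r A (c *\<^sub>C x) = c *\<^sub>C psd_root r A x"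
proof -
  have ap: "blinfun_apply (Blinfun (\<lambda>x :: 'a. c *\<^sub>C x)) = (\<lambda>x. c *\<^sub>C x)"
    by (rule bounded_linear_Blinfun_apply[OF bounded_linear_scaleC])
  show ?thesis
    using psd_root_intertwine[of A r A "Blinfun (\<lambda>x. c *\<^sub>C x)" x] A scale by (simp add: ap)
qed

text \<open>Existence and uniqueness of the positive root, which the definite description in
  \<open>positive_sqrt\<close> presupposes.\<close>

lemma positive_sqrt_eq_psd_root:
  fixes A :: "'a::complex_hilbert \<Rightarrow>\<^sub>L 'a"
  assumes A: "psd A" "norm A \<le> r" "0 < r" and scale: "\<And>c x. A (c *\<^sub>C x) = c *\<^sub>C A x"
  shows "positive_sqrt A = psd_root r A"
  unfolding positive_sqrt_def
proof (rule the_equality)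
  show "positive_operator (psd_root r A) \<and> psd_root r A \<circ> psd_root r A = A"
    using positive_operator_psd[OF psd_psd_root[OF A] psd_root_scaleC[OF A scale]]
      psd_root_square[OF A] by auto
  fix S assume S: "positive_operator S \<and> S \<circ> S = blinfun_apply A"
  then have ap: "blinfun_apply (Blinfun S) = S"
    by (simp add: positive_operator_def bounded_clinear_def bounded_linear_Blinfun_apply)
  have "Blinfun S = psd_root r A"
    using S by (intro psd_root_unique A positive_operator_imp_psd) (auto simp: ap fun_eq_iff)
  then show "S = psd_root r A" using ap by metis
qed

lemma operator_abs_eq_psd_root:
  fixes T :: "'a::complex_hilbert \<Rightarrow> 'a"
  assumes T: "bounded_clinear T"
    and r: "norm (Blinfun (hilbert_adjoint T)) * norm (Blinfun T) \<le> r" "0 < r"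
  shows "operator_abs T = psd_root r (Blinfun (hilbert_adjoint T) o\<^sub>L Blinfun T)"
    and "operator_abs T (c *\<^sub>C x) = c *\<^sub>C operator_abs T x"
    and "psd (psd_root r (Blinfun (hilbert_adjoint T) o\<^sub>L Blinfun T))"
proof -
  define F S where "F = Blinfun T" and "S = Blinfun (hilbert_adjoint T)"
  have F: "blinfun_apply F = T" and S: "blinfun_apply S = hilbert_adjoint T"
    using T bounded_clinear_hilbert_adjoint[OF T]
    by (simp_all add: F_def S_def bounded_clinear_def bounded_linear_Blinfun_apply)
  have A: "psd (S o\<^sub>L F)" "norm (S o\<^sub>L F) \<le> r"
    using order_trans[OF norm_blinfun_compose r(1)[folded F_def S_def]]
    by (auto intro!: psd_adjoint_compose
        simp: F S inner_eq_Re_cinner cinner_hilbert_adjoint[OF T])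
  have scale: "(S o\<^sub>L F) (c *\<^sub>C x) = c *\<^sub>C (S o\<^sub>L F) x" for c x
    using T bounded_clinear_hilbert_adjoint[OF T] by (simp add: F S bounded_clinear_def)
  have "blinfun_apply (S o\<^sub>L F) = hilbert_adjoint T \<circ> T" by (simp add: fun_eq_iff F S)
  then show eq: "operator_abs T = psd_root r (Blinfun (hilbert_adjoint T) o\<^sub>L Blinfun T)"
    using positive_sqrt_eq_psd_root[OF A r(2) scale] by (simp add: operator_abs_def F_def S_def)
  show "operator_abs T (c *\<^sub>C x) = c *\<^sub>C operator_abs T x"
    unfolding eq using psd_root_scaleC[OF A r(2) scale] by (simp add: F_def S_def)
  show "psd (psd_root r (Blinfun (hilbert_adjoint T) o\<^sub>L Blinfun T))"
    using psd_psd_root[OF A r(2)] by (simp add: F_def S_def)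
qed

lemma
  fixes T :: "'a::complex_hilbert \<Rightarrow> 'a"
  assumes T: "bounded_clinear T"
  shows bounded_linear_operator_abs: "bounded_linear (operator_abs T)"
    and operator_abs_nonneg: "0 \<le> operator_abs T x \<bullet> x"
    and operator_abs_scaleC: "operator_abs T (c *\<^sub>C x) = c *\<^sub>C operator_abs T x"
proof -
  \<comment> \<open>The summand 1 keeps \<open>r\<close> positive when \<open>T\<close> is
    zero.\<close>
  define r where "r = norm (Blinfun (hilbert_adjoint T)) * norm (Blinfun T) + 1"
  have r: "norm (Blinfun (hilbert_adjoint T)) * norm (Blinfun T) \<le> r" "0 < r"
    by (simp_all add: r_def add_nonneg_pos)
  note * = operator_abs_eq_psd_root[OF T r]
  show "bounded_linear (operator_abs T)" "0 \<le> operator_abs T x \<bullet> x"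
    unfolding *(1) using psd_nonneg[OF *(3)] by (auto intro: blinfun.bounded_linear_right)
  show "operator_abs T (c *\<^sub>C x) = c *\<^sub>C operator_abs T x" by (rule *(2))
qed

text \<open>The phase that makes the left side real is absorbed into \<open>x\<close>; the form of
  \<open>operator_abs T\<close> is invariant under unimodular factors.\<close>

lemma mixed_schwarz:
  fixes T :: "'a::complex_hilbert \<Rightarrow> 'a"
  assumes T: "bounded_clinear T"
  shows "(cmod (cinner (T x) y))\<^sup>2 \<le>
    (operator_abs T x \<bullet> x) * (operator_abs (hilbert_adjoint T) y \<bullet> y)"
proof -
  define F S where "F = Blinfun T" and "S = Blinfun (hilbert_adjoint T)"
  define r where "r = norm S * norm F + 1"
  have r: "norm S * norm F \<le> r" "norm F * norm S \<le> r" "0 < r"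
    by (simp_all add: r_def add_nonneg_pos mult.commute)
  have F: "blinfun_apply F = T" and S: "blinfun_apply S = hilbert_adjoint T"
    using T bounded_clinear_hilbert_adjoint[OF T]
    by (simp_all add: F_def S_def bounded_clinear_def bounded_linear_Blinfun_apply)
  have adj: "F u \<bullet> v = u \<bullet> S v" for u v
    by (simp add: F S inner_eq_Re_cinner cinner_hilbert_adjoint[OF T])
  have P: "operator_abs T = psd_root r (S o\<^sub>L F)"
    using operator_abs_eq_psd_root(1)[OF T] r by (simp add: F_def S_def)
  have Q: "operator_abs (hilbert_adjoint T) = psd_root r (F o\<^sub>L S)"
    using operator_abs_eq_psd_root(1)[OF bounded_clinear_hilbert_adjoint[OF T], of r] r
    by (simp add: hilbert_adjoint_hilbert_adjoint[OF T] F_def S_def)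
  obtain c where c: "cmod c = 1" "(c *\<^sub>C T x) \<bullet> y = cmod (cinner (T x) y)"
    by (rule cmod_cinner_phase)
  have "(cmod (cinner (T x) y))\<^sup>2 = (F (c *\<^sub>C x) \<bullet> y)\<^sup>2"
    using T c(2) by (simp add: F bounded_clinear_def)
  also have "\<dots> \<le> (operator_abs T (c *\<^sub>C x) \<bullet> (c *\<^sub>C x)) * (operator_abs (hilbert_adjoint T) y \<bullet> y)"
    unfolding P Q by (rule mixed_schwarz_real[OF adj r(1,3)])
  also have "operator_abs T (c *\<^sub>C x) \<bullet> (c *\<^sub>C x) = operator_abs T x \<bullet> x"
    by (simp add: operator_abs_scaleC[OF T] inner_scaleC_scaleC c(1))
  finally show ?thesis .
qed

section \<open>Numerical radius of block operators\<close>

lemma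
  fixes T :: "'a::complex_hilbert \<Rightarrow> 'a"
  assumes T: "bounded_linear T"
  shows numerical_radius_upper: "norm x = 1 \<Longrightarrow> cmod (cinner (T x) x) \<le> numerical_radius T"
    and numerical_radius_nonneg: "0 \<le> numerical_radius T"
proof -
  have "cmod (cinner (T x) x) \<le> onorm T" if "norm x = 1" for x
    using cmod_cinner_le[of "T x" x] onorm[OF T, of x] that by simp
  then have "bdd_above (insert 0 {cmod (cinner (T x) x) | x. norm x = 1})"
    by (auto intro!: bdd_aboveI[of _ "onorm T"])
  then show "norm x = 1 \<Longrightarrow> cmod (cinner (T x) x) \<le> numerical_radius T"
    "0 \<le> numerical_radius T"
    unfolding numerical_radius_def by (auto intro!: cSup_upper)
qed

lemma cmod_cinner_le_numerical_radius:
  fixes T :: "'a::complex_hilbert \<Rightarrow> 'a"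
  assumes T: "bounded_linear T"
  shows "cmod (cinner (T x) x) \<le> numerical_radius T * (norm x)\<^sup>2"
proof (cases "x = 0")
  case True
  then show ?thesis using cmod_cinner_le[of "T x" x] by simp
next
  case False
  define u where "u = (1 / norm x) *\<^sub>R x"
  have u: "norm u = 1" "x = norm x *\<^sub>R u" using False by (simp_all add: u_def)
  have "T x = norm x *\<^sub>R T u"
    using u(2) linear_simps(5)[OF T, of "norm x" u] by simp
  then have "cinner (T x) x = of_real (norm x) * (of_real (norm x) * cinner (T u) u)"
    using u(2) by (metis cinner_scaleR_left cinner_scaleR_right)
  then have "cmod (cinner (T x) x) = cmod (cinner (T u) u) * (norm x)\<^sup>2"
    by (simp add: norm_mult power2_eq_square)
  then show ?thesis
    using numerical_radius_upper[OF T u(1)] by (simp add: mult_right_mono)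
qed

text \<open>Cauchy-Schwarz in the plane for the vectors with entries \<open>sqrt a\<close>,
  \<open>sqrt c\<close> and \<open>sqrt b\<close>, \<open>sqrt d\<close>.\<close>

lemma cauchy_schwarz_two:
  fixes a b c d :: real
  assumes "0 \<le> a" "0 \<le> b" "0 \<le> c" "0 \<le> d"
  shows "sqrt (a * b) + sqrt (c * d) \<le> sqrt (a + c) * sqrt (b + d)"
proof -
  have "2 * (sqrt (a * d) * sqrt (c * b)) \<le> a * d + c * b"
    using sum_squares_bound[of "sqrt (a * d)" "sqrt (c * b)"] assms by simp
  moreover have "sqrt (a * b) * sqrt (c * d) = sqrt (a * d) * sqrt (c * b)"
    by (simp add: ac_simps flip: real_sqrt_mult)
  ultimately have "(sqrt (a * b) + sqrt (c * d))\<^sup>2 \<le> (a + c) * (b + d)"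
    using assms by (simp add: power2_sum algebra_simps)
  then show ?thesis by (simp add: real_le_rsqrt flip: real_sqrt_mult)
qed

text \<open>Mixed Schwarz bounds the terms by \<open>sqrt (a * b)\<close> and
  \<open>sqrt (c * d)\<close>. The planar inequality then groups \<open>a\<close> with
  \<open>c\<close>, both forms at \<open>y\<close>, and \<open>b\<close> with \<open>d\<close>, both
  at \<open>x\<close>; this produces the sums of absolute values.\<close>

lemma cross_terms_le:
  fixes T U :: "'a::complex_hilbert \<Rightarrow> 'a"
  assumes T: "bounded_clinear T" and U: "bounded_clinear U"
  shows "cmod (cinner (T y) x) + cmod (cinner (U x) y) \<le>
    (sqrt (onorm (\<lambda>x. operator_abs T x + operator_abs (hilbert_adjoint U) x)) *
     sqrt (onorm (\<lambda>x. operator_abs U x + operator_abs (hilbert_adjoint T) x))) * (norm x * norm y)"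
proof -
  note T' = bounded_clinear_hilbert_adjoint[OF T] and U' = bounded_clinear_hilbert_adjoint[OF U]
  define M N where "M = (\<lambda>x. operator_abs T x + operator_abs (hilbert_adjoint U) x)"
    and "N = (\<lambda>x. operator_abs U x + operator_abs (hilbert_adjoint T) x)"
  have lin: "bounded_linear M" "bounded_linear N"
    unfolding M_def N_def by (intro bounded_linear_add bounded_linear_operator_abs T U T' U')+
  have le: "sqrt (F z \<bullet> z) \<le> sqrt (onorm F) * norm z"
    if F: "bounded_linear F" for F :: "'a \<Rightarrow> 'a" and z
  proof -
    have "F z \<bullet> z \<le> onorm F * norm z * norm z"
      by (rule order_trans[OF norm_cauchy_schwarz mult_right_mono[OF onorm[OF F]]]) simp
    then have "sqrt (F z \<bullet> z) \<le> sqrt (onorm F * norm z * norm z)" by simp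
    then show ?thesis by (simp add: real_sqrt_mult mult.assoc)
  qed
  define a b c d where "a = operator_abs T y \<bullet> y" and "b = operator_abs (hilbert_adjoint T) x \<bullet> x"
    and "c = operator_abs (hilbert_adjoint U) y \<bullet> y" and "d = operator_abs U x \<bullet> x"
  have nn: "0 \<le> a" "0 \<le> b" "0 \<le> c" "0 \<le> d"
    unfolding a_def b_def c_def d_def by (intro operator_abs_nonneg T U T' U')+
  have "cmod (cinner (T y) x) + cmod (cinner (U x) y) \<le> sqrt (a * b) + sqrt (c * d)"
    using mixed_schwarz[OF T, of y x] mixed_schwarz[OF U, of x y]
    by (intro add_mono real_le_rsqrt) (simp_all add: a_def b_def c_def d_def mult.commute)
  also have "\<dots> \<le> sqrt (a + c) * sqrt (b + d)" by (rule cauchy_schwarz_two[OF nn])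
  also have "\<dots> = sqrt (M y \<bullet> y) * sqrt (N x \<bullet> x)"
    by (simp add: M_def N_def a_def b_def c_def d_def inner_add_left add.commute)
  also have "\<dots> \<le> (sqrt (onorm M) * norm y) * (sqrt (onorm N) * norm x)"
    using nn by (intro mult_mono le lin)
      (auto simp: onorm_pos_le lin N_def b_def d_def inner_add_left)
  finally show ?thesis by (simp add: M_def N_def ac_simps)
qed

lemma cmod_cinner_block_operator_le:
  fixes A :: "'n::{finite,linorder} \<Rightarrow> 'n \<Rightarrow> 'a::complex_hilbert \<Rightarrow> 'a"
    and m :: "'n \<Rightarrow> 'n \<Rightarrow> real"
  assumes diag: "\<And>i x. cmod (cinner (A i i x) x) \<le> m i i * (norm x)\<^sup>2"
    and off: "\<And>i j x y. i < j \<Longrightarrow>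
      cmod (cinner (A i j y) x) + cmod (cinner (A j i x) y) \<le> m i j * (norm x * norm y)"
    and lower: "\<And>i j. j < i \<Longrightarrow> m i j = 0"
    and x: "norm x = 1"
  shows "cmod (cinner (block_operator A x) x) \<le> numerical_radius ((*v) (\<chi> i j. complex_of_real (m i j)))"
proof -
  define M :: "((complex, 'n) vec, 'n) vec" where "M = (\<chi> i j. complex_of_real (m i j))"
  \<comment> \<open>The test vector for the scalar matrix: the norms of the components of
    \<open>x\<close>, again a unit vector.\<close>
  define z :: "(complex, 'n) vec" where "z = (\<chi> i. complex_of_real (norm (x $ i)))"
  define f where "f i j = cmod (cinner (A i j (x $ j)) (x $ i))" for i j :: 'n
  define g where "g i j = m i j * (norm (x $ i) * norm (x $ j))" for i j :: 'n
  have "norm z = norm x" by (simp add: norm_vec_def L2_set_def z_def)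
  then have z: "norm z = 1" using x by simp
  \<comment> \<open>Only symmetric pairs can be compared: the entry above the diagonal carries the
    bound for both cross terms, and its mirror image is 0.\<close>
  have fg: "f i j + f j i \<le> g i j + g j i" for i j
    using diag[of i "x $ i"] off[of i j "x $ j" "x $ i"] off[of j i "x $ i" "x $ j"]
      lower[of i j] lower[of j i]
    by (cases i j rule: linorder_cases) (auto simp: f_def g_def power2_eq_square)
  \<comment> \<open>Symmetrizing turns the pairwise comparison into one of full sums, with the
    diagonal counted twice on both sides.\<close>
  have double: "2 * (\<Sum>i\<in>UNIV. \<Sum>j\<in>UNIV. h i j) = (\<Sum>i\<in>UNIV. \<Sum>j\<in>UNIV. h i j + h j i)"
    for h :: "'n \<Rightarrow> 'n \<Rightarrow> real"
    using sum.swap[of "\<lambda>i j. h j i" UNIV UNIV] by (simp add: sum.distrib)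
  have "cinner (block_operator A x) x = (\<Sum>i\<in>UNIV. \<Sum>j\<in>UNIV. cinner (A i j (x $ j)) (x $ i))"
    by (simp add: cinner_vec_def block_operator_def cinner_sum_left)
  then have "cmod (cinner (block_operator A x) x) \<le> (\<Sum>i\<in>UNIV. \<Sum>j\<in>UNIV. f i j)"
    unfolding f_def by (auto intro!: sum_norm_le)
  also have "\<dots> \<le> (\<Sum>i\<in>UNIV. \<Sum>j\<in>UNIV. g i j)"
  proof -
    have "2 * (\<Sum>i\<in>UNIV. \<Sum>j\<in>UNIV. f i j) \<le> 2 * (\<Sum>i\<in>UNIV. \<Sum>j\<in>UNIV. g i j)"
      unfolding double by (intro sum_mono fg)
    then show ?thesis by simp
  qed
  also have "\<dots> \<le> cmod (complex_of_real (\<Sum>i\<in>UNIV. \<Sum>j\<in>UNIV. g i j))"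
    by (simp only: norm_of_real abs_ge_self)
  also have "complex_of_real (\<Sum>i\<in>UNIV. \<Sum>j\<in>UNIV. g i j) = cinner (M *v z) z"
    by (simp add: cinner_vec_def cinner_complex_def matrix_vector_mult_def M_def z_def g_def
        sum_distrib_left sum_distrib_right ac_simps)
  also have "cmod (cinner (M *v z) z) \<le> numerical_radius ((*v) M)"
    using z by (intro numerical_radius_upper matrix_vector_mul_bounded_linear)
  finally show ?thesis by (simp add: M_def)
qed

theorem corollary2p4:
  fixes A :: "'n::{finite,linorder} \<Rightarrow> 'n \<Rightarrow> 'a::complex_hilbert \<Rightarrow> 'a"
  assumes "\<And>i j. bounded_clinear (A i j)"
  shows "numerical_radius (block_operator A) \<le>
    numerical_radius ((*v) (\<chi> i j.
      if i = j then complex_of_real (numerical_radius (A i i))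
      else if i < j then complex_of_real
        (sqrt (onorm (\<lambda>x. operator_abs (A i j) x + operator_abs (hilbert_adjoint (A j i)) x)) *
         sqrt (onorm (\<lambda>x. operator_abs (A j i) x + operator_abs (hilbert_adjoint (A i j)) x)))
      else 0))"
    (is "_ \<le> numerical_radius ((*v) ?M)")
proof -
  define m where "m i j =
      (if i = j then numerical_radius (A i i)
       else if i < j then
         sqrt (onorm (\<lambda>x. operator_abs (A i j) x + operator_abs (hilbert_adjoint (A j i)) x)) *
         sqrt (onorm (\<lambda>x. operator_abs (A j i) x + operator_abs (hilbert_adjoint (A i j)) x))
       else 0)" for i j
  have M: "?M = (\<chi> i j. complex_of_real (m i j))" by (simp add: vec_eq_iff m_def)
  have "cmod (cinner (block_operator A x) x) \<le> numerical_radius ((*v) ?M)" if "norm x = 1" for x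
    unfolding M
  proof (rule cmod_cinner_block_operator_le[OF _ _ _ that])
    show "cmod (cinner (A i i x) x) \<le> m i i * (norm x)\<^sup>2" for i x
      using cmod_cinner_le_numerical_radius[of "A i i" x] assms[of i i]
      by (simp add: m_def bounded_clinear_def)
    show "cmod (cinner (A i j y) x) + cmod (cinner (A j i x) y) \<le> m i j * (norm x * norm y)"
      if "i < j" for i j x y
      using cross_terms_le[OF assms assms, of i j y x j i] less_imp_neq[OF that] that
      by (simp add: m_def)
    show "m i j = 0" if "j < i" for i j using that by (auto simp: m_def)
  qed
  \<comment> \<open>The supremum on the left also ranges over the inserted 0, which has to be
    bounded as well.\<close>
  moreover have "0 \<le> numerical_radius ((*v) ?M)"
    by (intro numerical_radius_nonneg matrix_vector_mul_bounded_linear)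
  ultimately show ?thesis
    unfolding numerical_radius_def[of "block_operator A"] by (intro cSup_least) auto
qed

end
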